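(* Let $n\geq 2$, $k\geq 1$, $a=2[n,n+1,\ldots,n+k]$, $b=L_nL_{n+1}\cdots L_{n+k}$ and $f_k(n)=\frac{L_nL_{n+1}\cdots L_{n+k}}{[L_n,L_{n+1},\ldots,L_{n+k}]}$. Then: (i) $b\mid f_k(n)F_{aj}$ for every integer $j\geq 1$. (ii) $z(b)=aj$ where $j$ is the smallest positive integer such that $b\mid F_{aj}$. In fact, $j$ is the smallest positive integer such that $v_p(b)\le v_p(F_{aj})$ for every prime $p$ dividing $f_k(n)$.
   Context: $F_n$ is the $n$th Fibonacci number ($F_1=F_2=1$, $F_n=F_{n-1}+F_{n-2}$) and $L_n$ the $n$th Lucas number ($L_1=1$, $L_2=3$, $L_n=L_{n-1}+L_{n-2}$). For a positive integer $m$, $z(m)$ is the smallest positive integer $k$ with $m\mid F_k$. $[\cdots]$ denotes lcm and $v_p$ the $p$-adic valuation. *)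

theory Defs
  imports "HOL-Number_Theory.Number_Theory"
begin

fun lucas :: "nat \<Rightarrow> nat" where
  "lucas 0 = 2"
| "lucas (Suc 0) = 1"
| "lucas (Suc (Suc n)) = lucas (Suc n) + lucas n"

lemma lucas_2: "lucas 2 = 3"
  by (simp add: numeral_2_eq_2)

(* The value is meaningful only if m divides some fib k with k > 0, as it does for every m > 0. *)
definition fib_rank :: "nat \<Rightarrow> nat" where
  "fib_rank m = (LEAST k. 0 < k \<and> m dvd fib k)"

definition lucas_quot :: "nat \<Rightarrow> nat \<Rightarrow> nat" where
  "lucas_quot k n = (\<Prod>i = n..n + k. lucas i) div (LCM i\<in>{n..n + k}. lucas i)"

(* The division in lucas_quot is exact. *)
lemma Lcm_lucas_dvd_prod_lucas:
  "(LCM i\<in>{n..n + k}. lucas i) dvd (\<Prod>i = n..n + k. lucas i)"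
  by (rule Lcm_least) auto

definition is_least_pos :: "(nat \<Rightarrow> bool) \<Rightarrow> nat \<Rightarrow> bool" where
  "is_least_pos P j \<longleftrightarrow> 0 < j \<and> P j \<and> (\<forall>i. 0 < i \<and> P i \<longrightarrow> j \<le> i)"

end

(* Since L_i divides F_(2i) = F_i L_i, the lcm of the L_i divides F_(aj); this gives (i) and
   settles all primes not dividing f_k(n). Conversely L_i | F_m forces 2i | m for i >= 2: with
   d = gcd(2i, m), L_i divides F_d, and d < 2i would give d <= i, hence F_d <= F_i < L_i.
   So every m with b | F_m is a multiple of a. *)
theory Submission
  imports Defs
begin

lemma lucas_Suc: "lucas (Suc n) = fib n + fib (Suc (Suc n))"
  by (induction n rule: fib.induct) auto

lemma lucas_pos: "lucas n > 0"
  by (induction n rule: lucas.induct) auto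

text \<open>For positive \<open>n\<close> the cofactor \<open>fib (n - 1) + fib (n + 1)\<close> in
  \<open>fib_rec_even\<close> is \<open>lucas n\<close>. Truncated subtraction breaks this at 0,
  where both sides vanish anyway.\<close>

lemma fib_double: "fib (2 * n) = fib n * lucas n"
  by (cases n) (simp_all only: fib_rec_even, simp_all add: lucas_Suc)

text \<open>The difference is \<open>2 * fib (i - 1)\<close>, which is positive from 2 on; at 1 both
  numbers equal 1.\<close>

lemma fib_less_lucas:
  assumes "i \<ge> 2"
  shows "fib i < lucas i"
proof -
  obtain m where "i = Suc (Suc m)"
    using assms by (metis Suc_le_D numeral_2_eq_2 Suc_le_mono)
  then show ?thesis by (simp add: lucas_Suc fib_neq_0_nat)
qed

lemma lucas_dvd_fib_iff:
  assumes "i \<ge> 2"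
  shows "lucas i dvd fib m \<longleftrightarrow> 2 * i dvd m"
proof
  assume "2 * i dvd m"
  then have "fib (2 * i) dvd fib m"
    by (metis fib_gcd gcd_nat.absorb_iff1)
  then show "lucas i dvd fib m"
    by (metis fib_double dvd_mult_right)
next
  assume *: "lucas i dvd fib m"
  define d where "d = gcd (2 * i) m"
  have "d > 0" using assms by (simp add: d_def)
  \<comment> \<open>\<open>fib\<close> commutes with \<open>gcd\<close>, and \<open>lucas i\<close>
    divides both \<open>fib (2 * i)\<close> and \<open>fib m\<close>.\<close>
  have dvd: "lucas i dvd fib d"
    using * by (simp add: d_def fib_gcd fib_double)
  have "d = 2 * i"
  proof (rule ccontr)
    assume "d \<noteq> 2 * i"
    moreover obtain c where c: "2 * i = d * c" by (metis d_def gcd_dvd1 dvdE)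
    moreover have "c \<noteq> 0" using c assms by (cases c) auto
    ultimately have "2 \<le> c" by (cases c) auto
    then have "d * 2 \<le> d * c" by simp
    then have "d \<le> i" using c by linarith
    then have "fib d \<le> fib i" by (rule fib_mono)
    moreover have "lucas i \<le> fib d"
      using dvd \<open>d > 0\<close> by (intro dvd_imp_le fib_neq_0_nat)
    ultimately show False using fib_less_lucas[OF assms] by linarith
  qed
  then show "2 * i dvd m" by (metis d_def gcd_dvd2)
qed

text \<open>The recurrence can be run backwards modulo \<open>m\<close>, so agreement of two
  consecutive terms descends to index 0, where \<open>fib 0 = 0\<close>.\<close>

lemma fib_cong_shift:
  assumes "[fib (r + d) = fib r] (mod m)" "[fib (Suc (r + d)) = fib (Suc r)] (mod m)"
  shows "m dvd fib d"
  using assms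
proof (induction r)
  case 0
  then show ?case by (simp add: cong_0_iff)
next
  case (Suc r)
  have "[fib (Suc (r + d)) + fib (r + d) = fib (Suc r) + fib r] (mod m)"
    using Suc.prems(2) by simp
  then have "[fib (r + d) = fib r] (mod m)"
    using Suc.prems(1) by (metis cong_add_lcancel_nat cong_add_rcancel_nat cong_trans cong_add cong_refl cong_sym add_Suc)
  then show ?case using Suc by simp
qed

text \<open>Pigeonhole: only finitely many pairs of consecutive residues modulo \<open>m\<close>
  exist, so some pair recurs, and the distance between its two positions is a suitable
  index.\<close>

lemma ex_dvd_fib:
  assumes "m > 0"
  shows "\<exists>d>0. m dvd fib d"
proof -
  define f where "f r = (fib r mod m, fib (Suc r) mod m)" for r
  have "range f \<subseteq> {..<m} \<times> {..<m}" using assms by (auto simp: f_def)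
  then have "finite (range f)" by (rule finite_subset) simp
  then have "\<not> inj f" using finite_imageD infinite_UNIV_nat by blast
  then obtain r s where "r < s" "f r = f s"
    by (metis injI linorder_neqE_nat)
  then have "m dvd fib (s - r)"
    using fib_cong_shift[of r "s - r" m] by (simp add: f_def cong_def)
  then show ?thesis using \<open>r < s\<close> by (intro exI[of _ "s - r"]) simp
qed

lemma lucas_quot_mult_Lcm:
  "lucas_quot k n * (LCM i\<in>{n..n + k}. lucas i) = (\<Prod>i = n..n + k. lucas i)"
  unfolding lucas_quot_def by (rule dvd_div_mult_self[OF Lcm_lucas_dvd_prod_lucas])

text \<open>A prime not dividing \<open>c\<close> has the same multiplicity in \<open>c * x\<close>
  as in \<open>x\<close>. With \<open>c\<close> the Lucas quotient, this lets (i) settle all primes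
  outside it.\<close>

lemma multiplicity_le_of_dvd_mult:
  fixes p b c x :: nat
  assumes "prime p" "\<not> p dvd c" "b dvd c * x" "c * x \<noteq> 0"
  shows "multiplicity p b \<le> multiplicity p x"
proof -
  have "multiplicity p b \<le> multiplicity p (c * x)"
    using assms by (intro dvd_imp_multiplicity_le)
  also have "\<dots> = multiplicity p x"
    using assms by (simp add: prime_elem_multiplicity_mult_distrib not_dvd_imp_multiplicity_0)
  finally show ?thesis .
qed

lemma is_least_pos_cong:
  assumes "\<And>i. i > 0 \<Longrightarrow> P i \<longleftrightarrow> Q i"
  shows "is_least_pos P j \<longleftrightarrow> is_least_pos Q j"
  using assms unfolding is_least_pos_def by blast

lemma is_least_pos_Least:
  assumes "0 < i" "P i"
  shows "is_least_pos P (LEAST j. 0 < j \<and> P j)"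
  using LeastI[of "\<lambda>j. 0 < j \<and> P j" i] Least_le[of "\<lambda>j. 0 < j \<and> P j"] assms
  unfolding is_least_pos_def by auto

lemma fib_rank_eqI:
  assumes "is_least_pos (\<lambda>i. m dvd fib i) j"
  shows "fib_rank m = j"
  unfolding fib_rank_def by (rule Least_equality) (use assms in \<open>auto simp: is_least_pos_def\<close>)

theorem theorem4p4:
  fixes n k a b :: nat
  assumes "n \<ge> 2" and "k \<ge> 1"
    and "a = 2 * Lcm {n..n + k}"
    and "b = (\<Prod>i = n..n + k. lucas i)"
  shows "(\<forall>j\<ge>1. b dvd lucas_quot k n * fib (a * j)) \<and>
    (\<exists>j. is_least_pos (\<lambda>i. b dvd fib (a * i)) j \<and>
         fib_rank b = a * j \<and>
         is_least_pos
           (\<lambda>i. \<forall>p. prime p \<and> p dvd lucas_quot k n \<longrightarrow>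
                  multiplicity p b \<le> multiplicity p (fib (a * i))) j)"
proof -
  have b: "b = lucas_quot k n * (LCM i\<in>{n..n + k}. lucas i)"
    using assms by (simp add: lucas_quot_mult_Lcm)
  have "b > 0" unfolding assms by (intro prod_pos) (simp add: lucas_pos)
  have "lucas_quot k n > 0" using b \<open>b > 0\<close> by (intro gr0I) simp
  have "a > 0"
    using assms by (auto intro!: gr0I simp: Lcm_0_iff)
  have "(LCM i\<in>{n..n + k}. lucas i) dvd fib (a * j)" for j
  proof (rule Lcm_least)
    fix l assume "l \<in> lucas ` {n..n + k}"
    then obtain i where i: "i \<in> {n..n + k}" "l = lucas i" by blast
    then have "2 * i dvd a" unfolding assms by (intro mult_dvd_mono dvd_Lcm) auto
    then show "l dvd fib (a * j)" using i assms by (simp add: lucas_dvd_fib_iff)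
  qed
  \<comment> \<open>This is (i): \<open>b\<close> is the quotient times the lcm, and the lcm divides
    \<open>fib (a * j)\<close>.\<close>
  then have dvd: "b dvd lucas_quot k n * fib (a * j)" for j
    unfolding b by (intro mult_dvd_mono) auto
  have a_dvd: "a dvd m" if "b dvd fib m" for m
  proof -
    have *: "2 * i dvd m" if "i \<in> {n..n + k}" for i
    proof -
      have "lucas i dvd b" unfolding assms using that by (intro dvd_prodI) auto
      then show ?thesis
        using that assms \<open>b dvd fib m\<close> lucas_dvd_fib_iff[of i m] by (auto intro: dvd_trans)
    qed
    \<comment> \<open>The factor 2 is split off first, so that the lcm of the \<open>i\<close>
      themselves can be tested against \<open>m / 2\<close>.\<close>
    have "even m" using *[of n] by (auto dest: dvd_mult_left)
    then obtain q where "m = 2 * q" by blast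
    then have "Lcm {n..n + k} dvd q" using * by (intro Lcm_least) auto
    then show ?thesis using \<open>m = 2 * q\<close> assms by simp
  qed
  obtain d where "d > 0" "b dvd fib d" using ex_dvd_fib \<open>b > 0\<close> by blast
  moreover from this obtain e where "d = a * e" using a_dvd by blast
  ultimately have "\<exists>j. is_least_pos (\<lambda>i. b dvd fib (a * i)) j"
    using is_least_pos_Least[of e "\<lambda>i. b dvd fib (a * i)"] by (intro exI) auto
  then obtain j where j: "is_least_pos (\<lambda>i. b dvd fib (a * i)) j" by blast
  \<comment> \<open>Minimality among multiples of \<open>a\<close> is minimality among all indices,
    by \<open>a_dvd\<close>.\<close>
  have "is_least_pos (\<lambda>i. b dvd fib i) (a * j)"
    unfolding is_least_pos_def
  proof (intro conjI allI impI)
    fix m assume m: "0 < m \<and> b dvd fib m"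
    then obtain q where q: "m = a * q" using a_dvd by blast
    then have "j \<le> q" using j m by (auto simp: is_least_pos_def)
    then show "a * j \<le> m" using q by simp
  qed (use j \<open>a > 0\<close> in \<open>auto simp: is_least_pos_def\<close>)
  moreover have "b dvd fib (a * i) \<longleftrightarrow>
      (\<forall>p. prime p \<and> p dvd lucas_quot k n \<longrightarrow> multiplicity p b \<le> multiplicity p (fib (a * i)))"
    if "i > 0" for i
  proof -
    \<comment> \<open>Multiplicities reflect divisibility only for nonzero numbers: in HOL
      \<open>multiplicity p 0 = 0\<close>, although everything divides 0.\<close>
    have nz: "fib (a * i) \<noteq> 0" using that \<open>a > 0\<close> by (simp add: fib_neq_0_nat)
    have "b dvd fib (a * i) \<longleftrightarrow> (\<forall>p. prime p \<longrightarrow> multiplicity p b \<le> multiplicity p (fib (a * i)))"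
      using \<open>b > 0\<close> nz
      by (auto intro: multiplicity_le_imp_dvd dvd_imp_multiplicity_le)
    moreover have "multiplicity p b \<le> multiplicity p (fib (a * i))"
      if "prime p" "\<not> p dvd lucas_quot k n" for p
      using that nz \<open>lucas_quot k n > 0\<close>
      by (intro multiplicity_le_of_dvd_mult[OF _ _ dvd[of i]]) auto
    ultimately show ?thesis by blast
  qed
  ultimately show ?thesis
    using dvd j fib_rank_eqI is_least_pos_cong
      [of "\<lambda>i. b dvd fib (a * i)" "\<lambda>i. \<forall>p. prime p \<and> p dvd lucas_quot k n \<longrightarrow>
        multiplicity p b \<le> multiplicity p (fib (a * i))" j]
    by blast
qed

end
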